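(* Let $G$ be a group, $H$ a subgroup of $G$ of index $2$, $J\leq H$, $l\in H$, and $r\in G\setminus H$. (a) The coloring associated with the partition $P=\{h(J\cup Jr):h\in H\}$ of $G$ is perfect if and only if $rJ=Jr$ (i.e. $r\in N_G(J)$) and $r^2\in J$. (b) The coloring associated with $P=\{h(J\cup Jr):h\in H\}$ is perfect if and only if the coloring associated with the partition $P^l(r^l)=\{h(J^l\cup J^lr^l):h\in H\}$ of $G$ is perfect, where $J^l=lJl^{-1}$ and $r^l=lrl^{-1}$.
   Context: $G$ acts on partitions of $G$ by left multiplication, $gP=\{gB:B\in P\}$. The coloring associated with a partition $P$ of $G$ is called perfect if $gP=P$ for all $g\in G$. *)

theory Defs
  imports "HOL-Algebra.Algebra" "HOL-Library.Disjoint_Sets"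
begin

no_notation (ASCII) subset_mset (infix \<open><#\<close> 50)

definition translate_partition ::
    "('a, 'b) monoid_scheme \<Rightarrow> 'a \<Rightarrow> 'a set set \<Rightarrow> 'a set set"
  where "translate_partition G g P = {g <#\<^bsub>G\<^esub> B |B. B \<in> P}"

(* A coloring of G is identified with its partition of the carrier into color classes. *)
definition perfect_coloring :: "('a, 'b) monoid_scheme \<Rightarrow> 'a set set \<Rightarrow> bool"
  where "perfect_coloring G P \<longleftrightarrow>
    partition_on (carrier G) P \<and> (\<forall>g \<in> carrier G. translate_partition G g P = P)"

definition two_coset_partition ::
    "('a, 'b) monoid_scheme \<Rightarrow> 'a set \<Rightarrow> 'a set \<Rightarrow> 'a \<Rightarrow> 'a set set"
  where "two_coset_partition G H J r = {h <#\<^bsub>G\<^esub> (J \<union> (J #>\<^bsub>G\<^esub> r)) |h. h \<in> H}"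

(* The partition_on conjunct of perfect_coloring always holds for these families. *)
lemma (in group) two_coset_partition_partition_on:
  assumes H: "subgroup H G" and index: "card (rcosets H) = 2"
    and J: "subgroup J G" and JH: "J \<subseteq> H" and r: "r \<in> carrier G - H"
  shows "partition_on (carrier G) (two_coset_partition G H J r)"
proof -
  have Hc: "\<And>x. x \<in> H \<Longrightarrow> x \<in> carrier G" and rc: "r \<in> carrier G"
    using H r by (auto dest: subgroup.mem_carrier)
  have Jc: "\<And>x. x \<in> J \<Longrightarrow> x \<in> carrier G" using JH Hc by blast
  have oJ: "\<one> \<in> J" by (rule subgroup.one_closed[OF J])
  have "H \<in> rcosets H" using H by (simp add: is_group subgroup.subgroup_in_rcosets)
  moreover have "H #> r \<in> rcosets H" using rc by (auto simp: RCOSETS_def)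
  moreover have "H #> r \<noteq> H" using H r rcos_self[OF rc H] by auto
  ultimately have "rcosets H = {H, H #> r}" using index by (auto simp: card_2_iff)
  hence cover: "carrier G = H \<union> (H #> r)" using rcosets_part_G[OF H] by auto
  have disj: "h \<otimes> r \<notin> H" if "h \<in> H" for h
  proof
    assume "h \<otimes> r \<in> H"
    hence "inv h \<otimes> (h \<otimes> r) \<in> H" using H that by (simp add: subgroup.m_closed subgroup.m_inv_closed)
    thus False using that r Hc rc by (simp add: m_assoc[symmetric])
  qed
  have cell: "x \<in> h <# (J \<union> (J #> r)) \<longleftrightarrow>
      x \<in> h <# J \<or> (\<exists>y \<in> h <# J. x = y \<otimes> r)" if "h \<in> H" for x h
    using that Hc Jc rc by (auto simp: l_coset_def r_coset_def m_assoc)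
  have sub: "h <# J \<subseteq> H" if "h \<in> H" for h
    using that JH H by (auto simp: l_coset_def subgroup.m_closed)
  have eq: "h <# J = k <# J" if "h \<in> H" "k \<in> H" "y \<in> h <# J" "y \<in> k <# J" for h k y
    using l_repr_independence[OF that(3) Hc[OF that(1)] J]
      l_repr_independence[OF that(4) Hc[OF that(2)] J] by simp
  have cong: "h <# (J \<union> (J #> r)) = k <# (J \<union> (J #> r))"
    if "h \<in> H" "k \<in> H" "h <# J = k <# J" for h k
    by (rule Set.set_eqI) (simp add: cell that)
  have self: "h \<in> h <# J" if "h \<in> H" for h
    using that oJ Hc by (force simp: l_coset_def)
  show ?thesis
    unfolding partition_on_def two_coset_partition_def
  proof (intro conjI)
    show "\<Union>{h <# (J \<union> (J #> r)) |h. h \<in> H} = carrier G"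
    proof (intro equalityI subsetI)
      fix x assume "x \<in> \<Union>{h <# (J \<union> (J #> r)) |h. h \<in> H}"
      thus "x \<in> carrier G" using Hc Jc rc by (auto simp: l_coset_def r_coset_def)
    next
      fix x assume "x \<in> carrier G"
      then consider "x \<in> H" | h where "h \<in> H" "x = h \<otimes> r"
        using cover by (auto simp: r_coset_def)
      thus "x \<in> \<Union>{h <# (J \<union> (J #> r)) |h. h \<in> H}"
        by cases (use cell self in blast)+
    qed
    show "disjoint {h <# (J \<union> (J #> r)) |h. h \<in> H}"
    proof (rule disjointI)
      fix A B assume "A \<in> {h <# (J \<union> (J #> r)) |h. h \<in> H}"
        and "B \<in> {h <# (J \<union> (J #> r)) |h. h \<in> H}" and ne: "A \<noteq> B"
      then obtain h k where hk: "h \<in> H" "k \<in> H"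
        and A: "A = h <# (J \<union> (J #> r))" and B: "B = k <# (J \<union> (J #> r))" by blast
      have False if x: "x \<in> A" "x \<in> B" for x
      proof -
        have hs: "y \<in> H" if "y \<in> h <# J" for y using that sub[OF hk(1)] by blast
        have ks: "y \<in> H" if "y \<in> k <# J" for y using that sub[OF hk(2)] by blast
        have inj: "y = z" if "y \<in> H" "z \<in> H" "y \<otimes> r = z \<otimes> r" for y z
          using that Hc rc by simp
        have "x \<in> h <# J \<or> (\<exists>y \<in> h <# J. x = y \<otimes> r)"
          using x(1) cell[OF hk(1)] by (simp add: A)
        moreover have "x \<in> k <# J \<or> (\<exists>y \<in> k <# J. x = y \<otimes> r)"
          using x(2) cell[OF hk(2)] by (simp add: B)
        ultimately obtain y where y: "y \<in> h <# J" "y \<in> k <# J"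
          using hs ks disj inj by blast
        have "A = B" unfolding A B by (rule cong[OF hk eq[OF hk y]])
        thus False using ne by simp
      qed
      thus "A \<inter> B = {}" by blast
    qed
    show "{} \<notin> {h <# (J \<union> (J #> r)) |h. h \<in> H}"
      using oJ by (auto simp: l_coset_def)
  qed
qed

lemma (in group) l_coset_eq_r_coset_iff_normalizer:
  assumes J: "subgroup J G" and r: "r \<in> carrier G"
  shows "r <# J = J #> r \<longleftrightarrow> r \<in> normalizer G J"
proof -
  have Jc: "J \<subseteq> carrier G" by (rule subgroup.subset[OF J])
  have "(r <# J) #> inv r = J \<longleftrightarrow> r <# J = J #> r"
  proof
    assume "(r <# J) #> inv r = J"
    hence "((r <# J) #> inv r) #> r = J #> r" by simp
    thus "r <# J = J #> r"
      using r l_coset_subset_G[OF Jc r] by (simp add: coset_mult_assoc)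
  next
    assume "r <# J = J #> r"
    thus "(r <# J) #> inv r = J" using r Jc by (simp add: coset_mult_assoc)
  qed
  thus ?thesis using r Jc by (simp add: normalizer_def stabilizer_def)
qed

end

theory Submission
  imports Defs
begin

text \<open>
  Put \<open>K = J \<union> Jr\<close>. As \<open>G = H \<union> Hr\<close>, the family \<open>{hK | h \<in> H}\<close> is invariant under \<open>G\<close> as soon as
  \<open>rK = K\<close>; conversely, if it is an invariant partition, then \<open>r\<inverse>K\<close> and \<open>K\<close> are two of its blocks that
  share the identity, so they agree. Now \<open>rK = rJ \<union> rJr\<close>, where \<open>rJ\<close> lies outside \<open>H\<close> and
  \<open>rJr\<close> inside, so \<open>rK = K\<close> means \<open>rJ = Jr\<close> and \<open>rJr = J\<close>; given the first equation, the second
  one is \<open>r\<^sup>2 \<in> J\<close>. Part (b) follows by conjugating \<open>rK = K\<close> with \<open>l\<close>.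
\<close>

context group
begin

text \<open>Neither \<open>x\<close> nor \<open>inv y\<close> lies in \<open>H\<close>, and index 2
  leaves a single coset besides \<open>H\<close>. Hence both lie in that coset, so
  \<open>x = h \<otimes> inv y\<close> for some \<open>h \<in> H\<close>.\<close>

lemma mult_mem_index_2_subgroup:
  assumes H: "subgroup H G" and index: "card (rcosets H) = 2"
    and x: "x \<in> carrier G - H" and y: "y \<in> carrier G - H"
  shows "x \<otimes> y \<in> H"
proof -
  have coset: "H #> z \<in> rcosets H \<and> H #> z \<noteq> H" if "z \<in> carrier G - H" for z
    using that rcos_self[OF _ H, of z] by (auto simp: RCOSETS_def)
  have y': "inv y \<in> carrier G - H"
    using y subgroup.m_inv_closed[OF H, of "inv y"] by auto
  have self: "H \<in> rcosets H" using H by (simp add: is_group subgroup.subgroup_in_rcosets)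
  obtain A B where "rcosets H = {A, B}" using index by (meson card_2_iff)
  hence "H #> x = H #> inv y"
    using self coset[OF x] coset[OF y'] by (metis insertE singletonD)
  hence "x \<in> H #> inv y" using rcos_self[OF _ H, of x] x by simp
  then obtain h where h: "h \<in> H" "x = h \<otimes> inv y" by (auto simp: r_coset_def)
  hence "x \<otimes> y = h" using y subgroup.mem_carrier[OF H] by (simp add: m_assoc)
  with h show ?thesis by simp
qed

lemma l_coset_Un: "g <# (A \<union> B) = (g <# A) \<union> (g <# B)"
  by (auto simp: l_coset_def)

lemma r_coset_Un: "(A \<union> B) #> g = (A #> g) \<union> (B #> g)"
  by (auto simp: r_coset_def)

lemma l_coset_inj:
  assumes "A \<subseteq> carrier G" "B \<subseteq> carrier G" "g \<in> carrier G"
  shows "g <# A = g <# B \<longleftrightarrow> A = B"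
  using assms by (metis l_inv inv_closed lcos_m_assoc lcos_mult_one)

lemma r_coset_inj:
  assumes "A \<subseteq> carrier G" "B \<subseteq> carrier G" "g \<in> carrier G"
  shows "A #> g = B #> g \<longleftrightarrow> A = B"
  using assms by (metis r_inv inv_closed coset_mult_assoc coset_mult_one)

lemma l_coset_r_coset_assoc:
  assumes "A \<subseteq> carrier G" "g \<in> carrier G" "h \<in> carrier G"
  shows "g <# (A #> h) = (g <# A) #> h"
  using assms by (auto simp: l_coset_def r_coset_def m_assoc subset_iff)

lemma perfect_two_coset_partition_iff_stabilizes:
  assumes H: "subgroup H G" and index: "card (rcosets H) = 2"
    and J: "subgroup J G" and JH: "J \<subseteq> H" and r: "r \<in> carrier G - H"
  shows "perfect_coloring G (two_coset_partition G H J r) \<longleftrightarrow>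
    r <# (J \<union> (J #> r)) = J \<union> (J #> r)"
    (is "perfect_coloring G ?P \<longleftrightarrow> r <# ?K = ?K")
proof -
  have rc: "r \<in> carrier G" using r by simp
  have Kc: "?K \<subseteq> carrier G"
    using subgroup.subset[OF J] r_coset_subset_G[OF _ rc] by simp
  have P: "?P = {h <# ?K |h. h \<in> H}" by (simp add: two_coset_partition_def)
  \<comment> \<open>This is the block with \<open>h = \<one>\<close>.\<close>
  have K: "?K \<in> ?P"
    using lcos_mult_one[OF Kc] subgroup.one_closed[OF H] unfolding P by fastforce
  show ?thesis
  proof
    assume perfect: "perfect_coloring G ?P"
    hence "translate_partition G (inv r) ?P = ?P" using rc by (simp add: perfect_coloring_def)
    hence mem: "inv r <# ?K \<in> ?P" using K unfolding translate_partition_def by blast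
    have oJ: "\<one> \<in> J" by (rule subgroup.one_closed[OF J])
    \<comment> \<open>The blocks \<open>inv r <# ?K\<close> and \<open>?K\<close> meet in
      \<open>\<one>\<close>: it is \<open>inv r \<otimes> r\<close> with \<open>r\<close> in
      \<open>J #> r\<close>, and it also lies in \<open>J\<close>.\<close>
    have "r \<in> ?K" using rcos_self[OF rc J] by simp
    hence "\<one> \<in> (inv r <# ?K) \<inter> ?K" using rc oJ by (force simp: l_coset_def)
    moreover have "disjoint ?P" using perfect partition_onD2 by (auto simp: perfect_coloring_def)
    ultimately have "inv r <# ?K = ?K" using disjointD[OF _ mem K] by blast
    thus "r <# ?K = ?K"
      using lcos_m_assoc[OF Kc rc, of "inv r"] rc lcos_mult_one[OF Kc] by simp
  next
    assume stab: "r <# ?K = ?K"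
    have translate: "g <# ?K \<in> ?P" if g: "g \<in> carrier G" for g
    proof (cases "g \<in> H")
      case False
      \<comment> \<open>For \<open>g\<close> outside \<open>H\<close>, the stabilizing equation
        gives \<open>g <# ?K = g <# (r <# ?K)\<close>, so \<open>g\<close> can be replaced by the
        representative \<open>g \<otimes> r\<close>, which lies in \<open>H\<close>.\<close>
      hence "g \<otimes> r \<in> H" using mult_mem_index_2_subgroup[OF H index _ r] g by simp
      moreover have "(g \<otimes> r) <# ?K = g <# ?K"
        using lcos_m_assoc[OF Kc g rc] stab by simp
      ultimately show ?thesis unfolding P by (metis (mono_tags, lifting) CollectI)
    qed (auto simp: P)
    have Hc: "h \<in> carrier G" if "h \<in> H" for h by (rule subgroup.mem_carrier[OF H that])
    have sub: "g <# B \<in> ?P" if g: "g \<in> carrier G" and B: "B \<in> ?P" for g B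
    proof -
      obtain h where h: "h \<in> H" "B = h <# ?K" using B unfolding P by blast
      thus ?thesis using lcos_m_assoc[OF Kc g Hc] translate[of "g \<otimes> h"] g Hc by simp
    qed
    have "translate_partition G g ?P = ?P" if g: "g \<in> carrier G" for g
    proof (intro equalityI subsetI)
      fix B assume "B \<in> translate_partition G g ?P"
      thus "B \<in> ?P" using sub[OF g] by (auto simp: translate_partition_def)
    next
      fix B assume B: "B \<in> ?P"
      have Bc: "B \<subseteq> carrier G"
        using B l_coset_subset_G[OF Kc] Hc unfolding P by blast
      \<comment> \<open>The reverse inclusion follows from closure under translation by
        \<open>inv g\<close>: the preimage of \<open>B\<close> is again a block.\<close>
      have "B = g <# (inv g <# B)" using g Bc by (simp add: lcos_m_assoc lcos_mult_one)
      thus "B \<in> translate_partition G g ?P"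
        using sub[OF _ B, of "inv g"] g unfolding translate_partition_def by blast
    qed
    thus "perfect_coloring G ?P"
      using two_coset_partition_partition_on[OF H index J JH r]
      by (simp add: perfect_coloring_def)
  qed
qed

lemma two_coset_stabilizes_iff:
  assumes H: "subgroup H G" and index: "card (rcosets H) = 2"
    and J: "subgroup J G" and JH: "J \<subseteq> H" and r: "r \<in> carrier G - H"
  shows "r <# (J \<union> (J #> r)) = J \<union> (J #> r) \<longleftrightarrow>
    r <# J = J #> r \<and> r [^] (2::nat) \<in> J"
proof -
  have rc: "r \<in> carrier G" using r by simp
  have Jc: "J \<subseteq> carrier G" by (rule subgroup.subset[OF J])
  \<comment> \<open>Multiplying by \<open>inv j\<close>, an element of \<open>H\<close>, would
    otherwise put \<open>r\<close> into \<open>H\<close>.\<close>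
  have Jr: "j \<otimes> r \<in> carrier G - H" and rJ: "r \<otimes> j \<in> carrier G - H" if "j \<in> J" for j
  proof -
    have j: "j \<in> H" "j \<in> carrier G" using that JH Jc by auto
    have "j \<otimes> r \<notin> H"
    proof
      assume "j \<otimes> r \<in> H"
      hence "inv j \<otimes> (j \<otimes> r) \<in> H" using j H by (simp add: subgroup.m_closed subgroup.m_inv_closed)
      thus False using j r by (simp add: m_assoc[symmetric])
    qed
    moreover have "r \<otimes> j \<notin> H"
    proof
      assume "r \<otimes> j \<in> H"
      hence "(r \<otimes> j) \<otimes> inv j \<in> H" using j H by (simp add: subgroup.m_closed subgroup.m_inv_closed)
      thus False using j r by (simp add: m_assoc)
    qed
    ultimately show "j \<otimes> r \<in> carrier G - H" "r \<otimes> j \<in> carrier G - H" using j rc by auto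
  qed
  have out: "(J #> r) \<inter> H = {}" "(r <# J) \<inter> H = {}"
    using Jr rJ by (auto simp: r_coset_def l_coset_def)
  have "r <# (J #> r) \<subseteq> H"
    using mult_mem_index_2_subgroup[OF H index r Jr] by (auto simp: r_coset_def l_coset_def)
  \<comment> \<open>Equality of the unions is compared separately inside and outside
    \<open>H\<close>: \<open>J\<close> and \<open>r <# (J #> r)\<close> lie inside,
    \<open>J #> r\<close> and \<open>r <# J\<close> outside.\<close>
  hence "r <# (J \<union> (J #> r)) = J \<union> (J #> r) \<longleftrightarrow> r <# J = J #> r \<and> r <# (J #> r) = J"
    using out JH unfolding l_coset_Un by blast
  moreover have "r <# (J #> r) = J \<longleftrightarrow> r [^] (2::nat) \<in> J" if "r <# J = J #> r"
  proof -
    \<comment> \<open>Regroup as \<open>(r <# J) #> r\<close> and substitute \<open>J #> r\<close>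
      for \<open>r <# J\<close>. A right coset of \<open>J\<close> equals \<open>J\<close> exactly
      when its representative lies in \<open>J\<close>.\<close>
    have "r <# (J #> r) = J #> (r \<otimes> r)"
      using l_coset_r_coset_assoc[OF Jc rc rc] that coset_mult_assoc[OF Jc rc rc] by simp
    moreover have "J #> (r \<otimes> r) = J \<longleftrightarrow> r \<otimes> r \<in> J"
      using coset_join1[OF _ _ J] coset_join2[OF _ J] rc by blast
    ultimately show ?thesis using rc by (simp add: numeral_2_eq_2)
  qed
  ultimately show ?thesis by blast
qed

text \<open>Conjugation by \<open>l\<close> takes \<open>K = J \<union> (J #> r)\<close> to
  \<open>Jl \<union> (Jl #> rl)\<close> and \<open>r <# K\<close> to the \<open>rl\<close>-translate
  of that set. Translations are injective on subsets of the carrier, so the two equations are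
  equivalent.\<close>

lemma two_coset_stabilizes_conjugate_iff:
  assumes J: "J \<subseteq> carrier G" and l: "l \<in> carrier G" and r: "r \<in> carrier G"
  defines "Jl \<equiv> (l <# J) #> inv l" and "rl \<equiv> l \<otimes> r \<otimes> inv l"
  shows "rl <# (Jl \<union> (Jl #> rl)) = Jl \<union> (Jl #> rl) \<longleftrightarrow>
    r <# (J \<union> (J #> r)) = J \<union> (J #> r)"
proof -
  let ?K = "J \<union> (J #> r)"
  have Kc: "?K \<subseteq> carrier G" using J r r_coset_subset_G by simp
  have lJ: "l <# J \<subseteq> carrier G" by (rule l_coset_subset_G[OF J l])
  have lK: "l <# ?K \<subseteq> carrier G" by (rule l_coset_subset_G[OF Kc l])
  have rlc: "rl \<in> carrier G" using l r by (simp add: rl_def)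
  have inv_rl: "inv l \<otimes> rl = r \<otimes> inv l" and rl_l: "rl \<otimes> l = l \<otimes> r"
    using l r by (simp_all add: rl_def m_assoc[symmetric]) (simp add: m_assoc)
  have "Jl #> rl = (l <# J) #> (r \<otimes> inv l)"
    using coset_mult_assoc[OF lJ _ rlc, of "inv l"] l inv_rl by (simp add: Jl_def)
  also have "\<dots> = (l <# (J #> r)) #> inv l"
    using l r J lJ by (simp add: coset_mult_assoc l_coset_r_coset_assoc)
  finally have Kl: "Jl \<union> (Jl #> rl) = (l <# ?K) #> inv l"
    by (simp add: Jl_def l_coset_Un r_coset_Un)
  have "rl <# ((l <# ?K) #> inv l) = ((rl \<otimes> l) <# ?K) #> inv l"
    using l_coset_r_coset_assoc[OF lK rlc] lcos_m_assoc[OF Kc rlc l] l by simp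
  also have "\<dots> = (l <# (r <# ?K)) #> inv l"
    using lcos_m_assoc[OF Kc l r] rl_l by simp
  finally show ?thesis
    using l r Kc l_coset_subset_G unfolding Kl by (simp add: r_coset_inj l_coset_inj)
qed

lemma subgroup_conjugate:
  assumes J: "subgroup J G" and l: "l \<in> carrier G"
  shows "subgroup ((l <# J) #> inv l) G"
proof -
  have Jc: "x \<in> carrier G" if "x \<in> J" for x by (rule subgroup.mem_carrier[OF J that])
  have eq: "(l <# J) #> inv l = {l \<otimes> j \<otimes> inv l |j. j \<in> J}"
    by (auto simp: l_coset_def r_coset_def)
  show ?thesis
  proof (rule subgroupI)
    show "(l <# J) #> inv l \<subseteq> carrier G" using Jc l by (auto simp: eq)
    show "(l <# J) #> inv l \<noteq> {}" using subgroup.one_closed[OF J] by (auto simp: eq)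
  next
    fix a assume "a \<in> (l <# J) #> inv l"
    then obtain j where j: "j \<in> J" "a = l \<otimes> j \<otimes> inv l" by (auto simp: eq)
    hence "inv a = l \<otimes> inv j \<otimes> inv l" using Jc l by (simp add: inv_mult_group m_assoc)
    thus "inv a \<in> (l <# J) #> inv l" using j subgroup.m_inv_closed[OF J] by (auto simp: eq)
  next
    fix a b assume "a \<in> (l <# J) #> inv l" "b \<in> (l <# J) #> inv l"
    then obtain i j where ij: "i \<in> J" "j \<in> J" "a = l \<otimes> i \<otimes> inv l" "b = l \<otimes> j \<otimes> inv l"
      by (auto simp: eq)
    \<comment> \<open>The inner factors of \<open>a \<otimes> b\<close> cancel; the equation is
      right-nested to match the form that \<open>m_assoc\<close> produces.\<close>
    have "inv l \<otimes> (l \<otimes> (j \<otimes> inv l)) = j \<otimes> inv l"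
      using ij Jc l by (simp add: m_assoc[symmetric])
    hence "a \<otimes> b = l \<otimes> (i \<otimes> j) \<otimes> inv l" using ij Jc l by (simp add: m_assoc)
    thus "a \<otimes> b \<in> (l <# J) #> inv l" using ij subgroup.m_closed[OF J] by (auto simp: eq)
  qed
qed

end

theorem theorem5:
  fixes G :: "('a, 'b) monoid_scheme" (structure)
    and H J :: "'a set" and l r :: 'a
  assumes "group G"
    and "subgroup H G" and "card (rcosets H) = 2"
    and "subgroup J G" and "J \<subseteq> H"
    and "l \<in> H" and "r \<in> carrier G - H"
  shows "(perfect_coloring G (two_coset_partition G H J r) \<longleftrightarrow>
            r <# J = J #> r \<and> r [^] (2::nat) \<in> J) \<and>
         (perfect_coloring G (two_coset_partition G H J r) \<longleftrightarrow>
            perfect_coloring G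
              (two_coset_partition G H ((l <# J) #> inv l) (l \<otimes> r \<otimes> inv l)))"
proof -
  interpret group G by fact
  interpret H: subgroup H G by fact
  have lc: "l \<in> carrier G" and rc: "r \<in> carrier G" using assms by auto
  \<comment> \<open>Since \<open>l \<in> H\<close>, conjugation by \<open>l\<close> preserves
    \<open>H\<close> and its complement, so the conjugated pair satisfies the same hypotheses as
    \<open>J\<close> and \<open>r\<close>.\<close>
  have JlH: "(l <# J) #> inv l \<subseteq> H"
    using \<open>J \<subseteq> H\<close> \<open>l \<in> H\<close> by (auto simp: l_coset_def r_coset_def)
  have "l \<otimes> r \<otimes> inv l \<notin> H"
  proof
    assume "l \<otimes> r \<otimes> inv l \<in> H"
    hence "inv l \<otimes> (l \<otimes> r \<otimes> inv l) \<otimes> l \<in> H" using \<open>l \<in> H\<close> by simp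
    also have "inv l \<otimes> (l \<otimes> r \<otimes> inv l) \<otimes> l = r"
      using lc rc by (simp add: m_assoc) (simp add: m_assoc[symmetric])
    finally show False using assms(7) by simp
  qed
  hence rl: "l \<otimes> r \<otimes> inv l \<in> carrier G - H" using lc rc by simp
  \<comment> \<open>The criterion is applied to both pairs with the same \<open>H\<close>;
    conjugation then links the two stabilizing equations.\<close>
  note stab = perfect_two_coset_partition_iff_stabilizes[OF assms(2,3)]
  show ?thesis
    using stab[OF assms(4,5,7)] two_coset_stabilizes_iff[OF assms(2-5,7)]
      stab[OF subgroup_conjugate[OF assms(4) lc] JlH rl]
      two_coset_stabilizes_conjugate_iff[OF subgroup.subset[OF assms(4)] lc rc]
    by simp
qed

end
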